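(* The isomorphic closure of the class of disjoint-union partial algebras of sets, viewed as a class of $\mathcal L(J)$-structures, is axiomatised by the set of first-order $\mathcal L(J)$-sentences $\{\rho_n\mid n<\omega\}$, where the sentences $\rho_n$ are those defined in the context. That is, an $\mathcal L(J)$-structure is isomorphic to a disjoint-union partial algebra of sets if and only if it satisfies $\rho_n$ for every $n<\omega$.
   Context: For sets $S,T$, the disjoint union $S\mathbin{\dot\cup}T$ equals $S\cup T$ if $S\cap T=\emptyset$, and is undefined otherwise. A disjoint-union partial algebra of sets is a subset $A\subseteq\wp(X)$, for some set $X$, closed under $\dot\cup$ wherever it is defined. It is viewed as a structure for the language $\mathcal L(J)$ with one ternary relation symbol $J$ (and equality), with $J(a,b,c)$ holding iff $a\mathbin{\dot\cup}b$ is defined and equal to $c$. Empty structures are allowed. For disjoint finite sets $V,W$ of first-order variables, define $\mathcal L(J)$-formulas $\mu_n(V,W)$, $n<\omega$, recursively by $$\mu_0(V,W)=\bigwedge_{v,v'\in V}\neg\exists c\,J(v,v',c)\ \wedge\bigwedge_{v\in V,\,w\in W}v\neq w,$$ where $c$ is a fresh variable (and the first conjunction includes the cases $v=v'$), and $$\mu_{n+1}(V,W)=\forall a,b\Big(\bigwedge_{v\in V}\big(J(a,b,v)\to\mu_n(V\cup\{a\},W)\vee\mu_n(V\cup\{b\},W)\big)\wedge\bigwedge_{v\in V}\big(J(a,v,b)\to\mu_n(V\cup\{b\},W)\big)\wedge\bigwedge_{v\in V}\big(J(v,a,b)\to\mu_n(V\cup\{b\},W)\big)\Big),$$ where $a$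 and $b$ are fresh variables. Let $\rho_0=\top$ and $$\rho_{n+1}=\forall a,b\Big(\big(a=b\vee\mu_n(\{a\},\{b\})\vee\mu_n(\{b\},\{a\})\big)\wedge\big(\exists c\,J(a,b,c)\vee\mu_n(\{a,b\},\emptyset)\big)\Big),$$ where $a,b,c$ are fresh variables. *)

theory Defs
  imports Main
begin

section \<open>Structures with one ternary relation\<close>

text \<open>
  The carrier may be empty. Isomorphism and truth of sentences only depend on the relation on
  the carrier, so its values elsewhere are irrelevant.
\<close>

record 'a jstructure =
  carrier :: "'a set"
  Jrel :: "'a \<Rightarrow> 'a \<Rightarrow> 'a \<Rightarrow> bool"

definition isomorphic :: "'a jstructure \<Rightarrow> 'b jstructure \<Rightarrow> bool" where
  "isomorphic S T \<longleftrightarrow>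
     (\<exists>f. bij_betw f (carrier S) (carrier T) \<and>
       (\<forall>a\<in>carrier S. \<forall>b\<in>carrier S. \<forall>c\<in>carrier S.
          Jrel S a b c \<longleftrightarrow> Jrel T (f a) (f b) (f c)))"


section \<open>Disjoint-union partial algebras of sets\<close>

definition disj_union :: "'x set \<Rightarrow> 'x set \<Rightarrow> 'x set option" where
  "disj_union S T = (if S \<inter> T = {} then Some (S \<union> T) else None)"

definition disj_union_partial_algebra :: "'x set \<Rightarrow> 'x set set \<Rightarrow> bool" where
  "disj_union_partial_algebra X A \<longleftrightarrow>
     A \<subseteq> Pow X \<and> (\<forall>S\<in>A. \<forall>T\<in>A. \<forall>U. disj_union S T = Some U \<longrightarrow> U \<in> A)"

definition set_structure :: "'x set set \<Rightarrow> 'x set jstructure" where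
  "set_structure A = \<lparr>carrier = A, Jrel = (\<lambda>a b c. disj_union a b = Some c)\<rparr>"

definition representable_over :: "'x set \<Rightarrow> 'a jstructure \<Rightarrow> bool" where
  "representable_over X S \<longleftrightarrow>
     (\<exists>A. disj_union_partial_algebra X A \<and> isomorphic S (set_structure A))"

text \<open>
  ``For some set \<open>X\<close>'' cannot quantify over all types at once.  Points of a base set that
  lie in the same members of the algebra can be identified, so a base set whose points are
  sets of elements of the structure always suffices.
\<close>

lemma representable_over_canonical:
  fixes X :: "'x set" and S :: "'a jstructure"
  assumes "representable_over X S"
  shows "\<exists>Y :: 'a set set. representable_over Y S"
proof -
  obtain A f where A: "disj_union_partial_algebra X A" and f: "bij_betw f (carrier S) A"
    and J: "\<And>a b c. a \<in> carrier S \<Longrightarrow> b \<in> carrier S \<Longrightarrow> c \<in> carrier S \<Longrightarrow>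
      Jrel S a b c \<longleftrightarrow> disj_union (f a) (f b) = Some (f c)"
    using assms unfolding representable_over_def isomorphic_def set_structure_def by auto
  define p where "p x = {m \<in> carrier S. x \<in> f m}" for x
  define g where "g m = p ` f m" for m
  have mem: "p x \<in> g m \<longleftrightarrow> x \<in> f m" if "m \<in> carrier S" for x m
    using that unfolding g_def p_def by blast
  have g_form: "\<exists>x. y = p x" if "y \<in> g m" for y m
    using that unfolding g_def by blast
  have inj: "inj_on g (carrier S)"
  proof (rule inj_onI)
    fix a b assume ab: "a \<in> carrier S" "b \<in> carrier S" "g a = g b"
    have "f a = f b" using mem ab by blast
    then show "a = b" using f ab by (auto simp: bij_betw_def inj_on_def)
  qed
  have disj: "g a \<inter> g b = {} \<longleftrightarrow> f a \<inter> f b = {}" if "a \<in> carrier S" "b \<in> carrier S" for a b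
    using mem[OF that(1)] mem[OF that(2)] g_form by (metis disjoint_iff)
  have un: "g a \<union> g b = g c \<longleftrightarrow> f a \<union> f b = f c"
    if "a \<in> carrier S" "b \<in> carrier S" "c \<in> carrier S" for a b c
  proof
    assume "f a \<union> f b = f c" then show "g a \<union> g b = g c" unfolding g_def by blast
  next
    assume "g a \<union> g b = g c"
    then show "f a \<union> f b = f c"
      using mem[OF that(1)] mem[OF that(2)] mem[OF that(3)] by (metis Un_iff set_eqI)
  qed
  have J': "Jrel S a b c \<longleftrightarrow> disj_union (g a) (g b) = Some (g c)"
    if "a \<in> carrier S" "b \<in> carrier S" "c \<in> carrier S" for a b c
    using J[OF that] disj[OF that(1,2)] un[OF that] by (simp add: disj_union_def)
  have closed: "g a \<union> g b \<in> g ` carrier S"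
    if "a \<in> carrier S" "b \<in> carrier S" "g a \<inter> g b = {}" for a b
  proof -
    have "f a \<in> A" "f b \<in> A" using f that by (auto simp: bij_betw_def)
    moreover have "disj_union (f a) (f b) = Some (f a \<union> f b)"
      using disj[OF that(1,2)] that(3) by (simp add: disj_union_def)
    ultimately have "f a \<union> f b \<in> A"
      using A unfolding disj_union_partial_algebra_def by blast
    then obtain c where "c \<in> carrier S" "f a \<union> f b = f c"
      using f unfolding bij_betw_def by (metis imageE)
    then show ?thesis using un[OF that(1,2)] by blast
  qed
  have "disj_union_partial_algebra UNIV (g ` carrier S)"
    using closed unfolding disj_union_partial_algebra_def disj_union_def
    by (auto split: if_splits)
  moreover have "isomorphic S (set_structure (g ` carrier S))"
    unfolding isomorphic_def set_structure_def
    by (rule exI[of _ g]) (simp add: J' inj bij_betw_def)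
  ultimately show ?thesis unfolding representable_over_def by blast
qed


section \<open>First-order formulas and satisfaction\<close>

type_synonym var = nat

datatype fm =
    Tr
  | Eq var var
  | JAt var var var
  | Neg fm
  | And fm fm
  | Or fm fm
  | Imp fm fm
  | All var fm
  | Ex var fm

primrec fv :: "fm \<Rightarrow> var set" where
  "fv Tr = {}"
| "fv (Eq x y) = {x, y}"
| "fv (JAt x y z) = {x, y, z}"
| "fv (Neg p) = fv p"
| "fv (And p q) = fv p \<union> fv q"
| "fv (Or p q) = fv p \<union> fv q"
| "fv (Imp p q) = fv p \<union> fv q"
| "fv (All x p) = fv p - {x}"
| "fv (Ex x p) = fv p - {x}"

primrec sat :: "'a jstructure \<Rightarrow> (var \<Rightarrow> 'a) \<Rightarrow> fm \<Rightarrow> bool" where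
  "sat S e Tr \<longleftrightarrow> True"
| "sat S e (Eq x y) \<longleftrightarrow> e x = e y"
| "sat S e (JAt x y z) \<longleftrightarrow> Jrel S (e x) (e y) (e z)"
| "sat S e (Neg p) \<longleftrightarrow> \<not> sat S e p"
| "sat S e (And p q) \<longleftrightarrow> sat S e p \<and> sat S e q"
| "sat S e (Or p q) \<longleftrightarrow> sat S e p \<or> sat S e q"
| "sat S e (Imp p q) \<longleftrightarrow> (sat S e p \<longrightarrow> sat S e q)"
| "sat S e (All x p) \<longleftrightarrow> (\<forall>m\<in>carrier S. sat S (e(x := m)) p)"
| "sat S e (Ex x p) \<longleftrightarrow> (\<exists>m\<in>carrier S. sat S (e(x := m)) p)"

lemma sat_cong:
  "(\<And>x. x \<in> fv p \<Longrightarrow> e x = e' x) \<Longrightarrow> sat S e p \<longleftrightarrow> sat S e' p"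
proof (induction p arbitrary: e e')
  case (And p q)
  have "sat S e p \<longleftrightarrow> sat S e' p" "sat S e q \<longleftrightarrow> sat S e' q"
    by (rule And.IH; use And.prems in simp)+
  then show ?case by simp
next
  case (Or p q)
  have "sat S e p \<longleftrightarrow> sat S e' p" "sat S e q \<longleftrightarrow> sat S e' q"
    by (rule Or.IH; use Or.prems in simp)+
  then show ?case by simp
next
  case (Imp p q)
  have "sat S e p \<longleftrightarrow> sat S e' p" "sat S e q \<longleftrightarrow> sat S e' q"
    by (rule Imp.IH; use Imp.prems in simp)+
  then show ?case by simp
next
  case (Neg p)
  have "sat S e p \<longleftrightarrow> sat S e' p" by (rule Neg.IH; use Neg.prems in simp)
  then show ?case by simp
next
  case (All x p)
  have "sat S (e(x := m)) p \<longleftrightarrow> sat S (e'(x := m)) p" for m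
    by (rule All.IH; use All.prems in simp)
  then show ?case by simp
next
  case (Ex x p)
  have "sat S (e(x := m)) p \<longleftrightarrow> sat S (e'(x := m)) p" for m
    by (rule Ex.IH; use Ex.prems in simp)
  then show ?case by simp
qed simp_all

definition sentence :: "fm \<Rightarrow> bool" where
  "sentence p \<longleftrightarrow> fv p = {}"

text \<open>
  Assignments are not required to take values in the carrier: no such assignment exists for
  the empty structure, and every sentence would then hold in it vacuously.  By \<open>sat_cong\<close>
  the truth value of a sentence does not depend on the assignment.
\<close>

definition models :: "'a jstructure \<Rightarrow> fm set \<Rightarrow> bool" where
  "models S \<Gamma> \<longleftrightarrow> (\<forall>p\<in>\<Gamma>. \<forall>e. sat S e p)"


section \<open>The formulas \<open>\<mu>\<close> and \<open>\<rho>\<close>\<close>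

text \<open>
  For finite \<open>V\<close>; the empty conjunction is \<open>Tr\<close>.
\<close>

definition BigAnd :: "var set \<Rightarrow> (var \<Rightarrow> fm) \<Rightarrow> fm" where
  "BigAnd V p = foldr (\<lambda>v. And (p v)) (sorted_list_of_set V) Tr"

definition fresh :: "var set \<Rightarrow> var" where
  "fresh V = (LEAST x. x \<notin> V)"

primrec mu :: "nat \<Rightarrow> var set \<Rightarrow> var set \<Rightarrow> fm" where
  "mu 0 V W =
     (let c = fresh (V \<union> W) in
      And (BigAnd V (\<lambda>v. BigAnd V (\<lambda>v'. Neg (Ex c (JAt v v' c)))))
          (BigAnd V (\<lambda>v. BigAnd W (\<lambda>w. Neg (Eq v w)))))"
| "mu (Suc n) V W =
     (let a = fresh (V \<union> W); b = fresh (V \<union> W \<union> {a}) in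
      All a (All b
        (And (BigAnd V (\<lambda>v. Imp (JAt a b v) (Or (mu n (V \<union> {a}) W) (mu n (V \<union> {b}) W))))
        (And (BigAnd V (\<lambda>v. Imp (JAt a v b) (mu n (V \<union> {b}) W)))
             (BigAnd V (\<lambda>v. Imp (JAt v a b) (mu n (V \<union> {b}) W)))))))"

primrec rho :: "nat \<Rightarrow> fm" where
  "rho 0 = Tr"
| "rho (Suc n) =
     (let a = 0; b = 1; c = 2 in
      All a (All b
        (And (Or (Eq a b) (Or (mu n {a} {b}) (mu n {b} {a})))
             (Or (Ex c (JAt a b c)) (mu n {a, b} {})))))"

lemma fresh_notin: "finite V \<Longrightarrow> fresh V \<notin> V"
  unfolding fresh_def using ex_new_if_finite[OF infinite_UNIV_nat] by (metis LeastI_ex)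

lemma sat_BigAnd: "finite V \<Longrightarrow> sat S e (BigAnd V p) \<longleftrightarrow> (\<forall>v\<in>V. sat S e (p v))"
proof -
  have "sat S e (foldr (\<lambda>v. And (p v)) vs Tr) \<longleftrightarrow> (\<forall>v\<in>set vs. sat S e (p v))" for vs
    by (induction vs) auto
  then show "finite V \<Longrightarrow> ?thesis" by (simp add: BigAnd_def)
qed

lemma fv_BigAnd: "finite V \<Longrightarrow> fv (BigAnd V p) = (\<Union>v\<in>V. fv (p v))"
proof -
  have "fv (foldr (\<lambda>v. And (p v)) vs Tr) = (\<Union>v\<in>set vs. fv (p v))" for vs
    by (induction vs) auto
  then show "finite V \<Longrightarrow> ?thesis" by (simp add: BigAnd_def)
qed

lemma fv_mu: "finite V \<Longrightarrow> finite W \<Longrightarrow> fv (mu n V W) \<subseteq> V \<union> W"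
proof (induction n arbitrary: V)
  case 0
  then show ?case by (auto simp: Let_def fv_BigAnd)
next
  case (Suc n)
  have "fv (mu n (insert x V) W) \<subseteq> insert x (V \<union> W)" for x
    using Suc.IH[of "insert x V"] Suc.prems by auto
  then show ?case using Suc.prems
    by (simp add: Let_def fv_BigAnd) blast
qed

lemma sentence_rho: "sentence (rho n)"
proof (cases n)
  case (Suc m)
  then show ?thesis
    using fv_mu[of "{0}" "{1}" m] fv_mu[of "{1}" "{0}" m] fv_mu[of "{0, 1}" "{}" m]
    by (auto simp: sentence_def)
qed (simp add: sentence_def)

end

theory Submission imports Defs begin

text \<open>
  A point of a represented structure is determined by the set of elements containing it, which is
  prime: a disjoint union belongs to it iff one of the two parts does, and no two of its members
  (equal or not) are disjoint. A structure is representable iff prime sets separate distinct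
  elements and meet every pair of elements without a disjoint union: map \<open>a\<close> to the set of
  prime sets containing \<open>a\<close>. Evaluating \<open>\<mu>\<^sub>n(V, W)\<close> amounts to playing \<open>n\<close> rounds of a
  game that extends \<open>V\<close> to a prime set avoiding \<open>W\<close>; if all the games can be survived, a
  maximal \<open>V\<close> all of whose finite parts survive all of them is prime.
\<close>

section \<open>The game on elements behind the formulas\<close>

primrec survives :: "'a jstructure \<Rightarrow> nat \<Rightarrow> 'a set \<Rightarrow> 'a set \<Rightarrow> bool" where
  "survives S 0 V W \<longleftrightarrow>
     (\<forall>v\<in>V. \<forall>v'\<in>V. \<forall>c\<in>carrier S. \<not> Jrel S v v' c) \<and> V \<inter> W = {}"
| "survives S (Suc n) V W \<longleftrightarrow>
     (\<forall>a\<in>carrier S. \<forall>b\<in>carrier S. \<forall>v\<in>V.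
        (Jrel S a b v \<longrightarrow> survives S n (insert a V) W \<or> survives S n (insert b V) W) \<and>
        (Jrel S a v b \<longrightarrow> survives S n (insert b V) W) \<and>
        (Jrel S v a b \<longrightarrow> survives S n (insert b V) W))"

text \<open>This moves the game from variables to elements: fresh variables leave the values on
  \<open>V\<close> and \<open>W\<close> alone, and their own values are the elements that may be
  added. Both \<open>V\<close> and the assignment change in each round, so the induction keeps them
  arbitrary.\<close>

lemma sat_mu:
  "finite V \<Longrightarrow> finite W \<Longrightarrow> sat S e (mu n V W) \<longleftrightarrow> survives S n (e ` V) (e ` W)"
proof (induction n arbitrary: V e)
  case 0
  define c where "c = fresh (V \<union> W)"
  have "c \<notin> V" using fresh_notin[of "V \<union> W"] 0 by (auto simp: c_def)
  then have "v \<noteq> c" if "v \<in> V" for v using that by blast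
  then show ?case using 0 by (auto simp: Let_def sat_BigAnd c_def[symmetric])
next
  case (Suc n)
  define a where "a = fresh (V \<union> W)"
  define b where "b = fresh (insert a (V \<union> W))"
  have a: "a \<notin> V" "a \<notin> W" using fresh_notin[of "V \<union> W"] Suc.prems by (auto simp: a_def)
  have b: "b \<notin> V" "b \<notin> W" "b \<noteq> a"
    using fresh_notin[of "insert a (V \<union> W)"] Suc.prems by (auto simp: b_def)
  have upd: "e(a := x, b := y) ` V = e ` V" "e(a := x, b := y) ` W = e ` W"
    "\<And>v. v \<in> V \<Longrightarrow> (e(a := x, b := y)) v = e v" for x y
    using a b by (auto intro!: image_cong)
  have "sat S (e(a := x, b := y)) (mu n (insert a V) W) \<longleftrightarrow> survives S n (insert x (e ` V)) (e ` W)"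
    "sat S (e(a := x, b := y)) (mu n (insert b V) W) \<longleftrightarrow> survives S n (insert y (e ` V)) (e ` W)"
    for x y
    using Suc.IH[of "insert a V" "e(a := x, b := y)"] Suc.IH[of "insert b V" "e(a := x, b := y)"]
      Suc.prems b(3) by (simp_all add: upd del: fun_upd_apply) simp_all
  then show ?case using Suc.prems upd(3) b(3)
    by (simp add: Let_def sat_BigAnd a_def[symmetric] b_def[symmetric] del: fun_upd_apply)
      (auto simp: ball_conj_distrib)
qed

lemma models_rho_iff:
  "models S {rho n | n. True} \<longleftrightarrow>
    (\<forall>n. \<forall>a\<in>carrier S. \<forall>b\<in>carrier S.
       (a = b \<or> survives S n {a} {b} \<or> survives S n {b} {a}) \<and>
       ((\<exists>c\<in>carrier S. Jrel S a b c) \<or> survives S n {a, b} {}))"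
    (is "_ \<longleftrightarrow> (\<forall>n. ?R n)")
proof -
  have R: "sat S e (rho (Suc n)) \<longleftrightarrow> ?R n" for e n
    by (simp add: Let_def sat_mu)
  have "models S {rho n | n. True} \<longleftrightarrow> (\<forall>n e. sat S e (rho n))"
    unfolding models_def by blast
  \<comment> \<open>Since \<open>rho 0\<close> is \<open>Tr\<close>, the index shift loses
    nothing.\<close>
  also have "\<dots> \<longleftrightarrow> (\<forall>n e. sat S e (rho (Suc n)))"
  proof (intro iffI allI)
    fix n e
    assume "\<forall>n e. sat S e (rho (Suc n))"
    then show "sat S e (rho n)" by (cases n) (simp_all only: rho.simps(1) sat.simps(1))
  qed blast
  finally show ?thesis unfolding R by simp
qed

section \<open>Prime sets and the number of rounds\<close>

definition prime_set :: "'a jstructure \<Rightarrow> 'a set \<Rightarrow> bool" where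
  "prime_set S U \<longleftrightarrow> U \<subseteq> carrier S \<and>
     (\<forall>x\<in>carrier S. \<forall>y\<in>carrier S. \<forall>z\<in>carrier S.
        Jrel S x y z \<longrightarrow> (z \<in> U \<longleftrightarrow> x \<in> U \<or> y \<in> U) \<and> \<not> (x \<in> U \<and> y \<in> U))"

text \<open>The strategy is to stay inside \<open>U\<close>: when an element of \<open>U\<close> is
  split, one part lies in \<open>U\<close>, and a forced move adds a disjoint union with a summand
  in \<open>U\<close>.\<close>

lemma prime_set_survives:
  assumes "prime_set S U"
  shows "V \<subseteq> U \<Longrightarrow> U \<inter> W = {} \<Longrightarrow> survives S n V W"
proof (induction n arbitrary: V)
  case 0
  then show ?case using assms unfolding prime_set_def survives.simps by blast
next
  case (Suc n)
  have V: "V \<subseteq> carrier S" using Suc.prems assms by (auto simp: prime_set_def)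
  have J: "z \<in> U \<longleftrightarrow> x \<in> U \<or> y \<in> U"
    if "Jrel S x y z" "x \<in> carrier S" "y \<in> carrier S" "z \<in> carrier S" for x y z
    using assms that unfolding prime_set_def by blast
  have ext: "survives S n (insert x V) W" if "x \<in> U" for x
    using Suc that by blast
  show ?case unfolding survives.simps
    using J ext V Suc.prems(1) by (meson subsetD)
qed

lemma survives_antimono:
  "survives S n V W \<Longrightarrow> V' \<subseteq> V \<Longrightarrow> survives S n V' W"
proof (induction n arbitrary: V V')
  case 0
  then show ?case by (auto simp: subset_iff)
next
  case (Suc n)
  have "survives S n (insert x V') W" if "survives S n (insert x V) W" for x
    using Suc.IH[OF that] Suc.prems(2) by blast
  then show ?case using Suc.prems unfolding survives.simps by (meson subsetD)
qed

text \<open>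
  \<open>\<mu>\<^sub>n\<^sub>+\<^sub>1(V, W)\<close> is vacuously true if no element of \<open>V\<close> occurs in a triple, so it does
  not imply \<open>\<mu>\<^sub>n(V, W)\<close> in general.
\<close>

definition live :: "'a jstructure \<Rightarrow> 'a \<Rightarrow> bool" where
  "live S v \<longleftrightarrow> (\<exists>a\<in>carrier S. \<exists>b\<in>carrier S. Jrel S a b v \<or> Jrel S a v b \<or> Jrel S v a b)"

text \<open>Liveness guarantees a playable round, and rounds only enlarge the set, so
  \<open>v\<close> stays available throughout the induction; in the base case the added element is
  dropped again.\<close>

lemma survives_SucD_live:
  assumes "live S v"
  shows "v \<in> V \<Longrightarrow> survives S (Suc n) V W \<Longrightarrow> survives S n V W"
proof (induction n arbitrary: V)
  case 0
  then obtain x where "survives S 0 (insert x V) W"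
    using assms unfolding live_def survives.simps(2) by meson
  then show ?case by (rule survives_antimono) blast
next
  case (Suc n)
  have "survives S n (insert x V) W" if "survives S (Suc n) (insert x V) W" for x
    using Suc.IH[OF _ that] Suc.prems(1) by blast
  then show ?case
    using Suc.prems(2) unfolding survives.simps(2)[of S "Suc n"] survives.simps(2)[of S n V]
    by meson
qed

text \<open>Without live elements no round can be played, so only depth 0 has content. There a
  forbidden triple would make \<open>v\<close> live, as \<open>V\<close> lies in the carrier, and
  disjointness from \<open>W\<close> must be assumed because a vacuous round does not check
  it.\<close>

lemma survives_SucD:
  assumes "survives S (Suc n) V W" "V \<inter> W = {}" "V \<subseteq> carrier S"
  shows "survives S n V W"
proof (cases "\<exists>v\<in>V. live S v")
  case True
  then show ?thesis using survives_SucD_live assms(1) by metis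
next
  case False
  then have dead: "\<not> Jrel S a b v \<and> \<not> Jrel S a v b \<and> \<not> Jrel S v a b"
    if "v \<in> V" "a \<in> carrier S" "b \<in> carrier S" for v a b
    using that unfolding live_def by blast
  show ?thesis
  proof (cases n)
    case 0
    have "\<not> Jrel S v v' c" if "v \<in> V" "v' \<in> V" "c \<in> carrier S" for v v' c
      using dead[of v v' c] that assms(3) by blast
    then show ?thesis using assms(2) 0 by simp
  next
    case (Suc k)
    then show ?thesis using dead by simp
  qed
qed

lemma survives_le:
  assumes "m \<le> n" "survives S n V W" "V \<inter> W = {}" "V \<subseteq> carrier S"
  shows "survives S m V W"
  using assms by (induction rule: inc_induct) (auto dest: survives_SucD simp del: survives.simps)

text \<open>This serves sets enlarged by an element not yet known to avoid \<open>W\<close>: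
  liveness replaces the disjointness hypothesis of \<open>survives_le\<close>.\<close>

lemma survives_le_live:
  assumes "m \<le> n" "survives S n V W" "v \<in> V" "live S v"
  shows "survives S m V W"
  using assms(1,2) by (induction rule: inc_induct)
    (auto dest: survives_SucD_live[OF assms(4,3)] simp del: survives.simps)

section \<open>From surviving all games to a prime set\<close>

lemma survives_imp_prime_set:
  assumes V: "V \<subseteq> carrier S" "finite V" and surv: "\<And>n. survives S n V W"
  obtains U where "prime_set S U" "V \<subseteq> U" "U \<inter> W = {}"
proof -
  \<comment> \<open>Goodness has finite character: a finite part of the union of a chain lies in one
    member, so Zorn's lemma applies.\<close>
  define good where
    "good U \<longleftrightarrow> U \<subseteq> carrier S \<and> (\<forall>F n. finite F \<longrightarrow> F \<subseteq> U \<longrightarrow> survives S n F W)" for U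
  have "good V" using V surv survives_antimono unfolding good_def by blast
  have "\<exists>U\<in>{U. good U \<and> V \<subseteq> U}. \<forall>X\<in>{U. good U \<and> V \<subseteq> U}. U \<subseteq> X \<longrightarrow> X = U"
  proof (rule subset_Zorn_nonempty)
    show "{U. good U \<and> V \<subseteq> U} \<noteq> {}" using \<open>good V\<close> by blast
    fix \<C> assume ne: "\<C> \<noteq> {}" and chain: "subset.chain {U. good U \<and> V \<subseteq> U} \<C>"
    have C: "good U" "V \<subseteq> U" if "U \<in> \<C>" for U
      using chain that by (auto simp: subset_chain_def)
    have "survives S n F W" if "finite F" "F \<subseteq> \<Union>\<C>" for F n
      using finite_subset_Union_chain[OF that ne chain] C(1) that(1) unfolding good_def by metis
    moreover have "\<Union>\<C> \<subseteq> carrier S"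
      using C(1) unfolding good_def by (meson Sup_least)
    moreover have "V \<subseteq> \<Union>\<C>"
      using C(2) ne by blast
    ultimately show "\<Union>\<C> \<in> {U. good U \<and> V \<subseteq> U}"
      unfolding good_def by simp
  qed
  then obtain U where U: "good U" "V \<subseteq> U" and max: "\<And>X. good X \<Longrightarrow> U \<subseteq> X \<Longrightarrow> X = U"
    using subset_trans by (metis (mono_tags, lifting) mem_Collect_eq)
  have UC: "U \<subseteq> carrier S" and fin: "\<And>F n. finite F \<Longrightarrow> F \<subseteq> U \<Longrightarrow> survives S n F W"
    using U(1) unfolding good_def by auto
  \<comment> \<open>Maximality in usable form: an element outside \<open>U\<close> fails together
    with some finite part of \<open>U\<close> at some depth.\<close>
  have in_U: "x \<in> U"
    if "x \<in> carrier S" "\<And>F n. finite F \<Longrightarrow> F \<subseteq> U \<Longrightarrow> survives S n (insert x F) W" for x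
  proof -
    have "survives S n F W" if "finite F" "F \<subseteq> insert x U" for F n
    proof -
      have "survives S n (insert x (F - {x})) W"
        by (rule \<open>\<And>F n. finite F \<Longrightarrow> F \<subseteq> U \<Longrightarrow> survives S n (insert x F) W\<close>) (use that in auto)
      then show ?thesis by (rule survives_antimono) blast
    qed
    then have "good (insert x U)" using UC that(1) unfolding good_def by blast
    then show ?thesis using max by blast
  qed
  have up: "z \<in> U"
    if J: "Jrel S x y z" "x \<in> carrier S" "y \<in> carrier S" "z \<in> carrier S" and "x \<in> U \<or> y \<in> U"
    for x y z
  proof (rule in_U[OF J(4)])
    fix F :: "'a set" and n assume F: "finite F" "F \<subseteq> U"
    from that(5) obtain u where u: "u \<in> U" "u = x \<or> u = y" by blast
    \<comment> \<open>The extra round is spent on the given triple, with \<open>u\<close> as the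
      summand already present; it forces \<open>z\<close> in.\<close>
    have "survives S (Suc n) (insert u F) W" using F u by (intro fin) auto
    then have "survives S n (insert z (insert u F)) W"
      unfolding survives.simps using J u(2) by blast
    then show "survives S n (insert z F) W" by (rule survives_antimono) blast
  qed
  have prime: "x \<in> U \<or> y \<in> U"
    if J: "Jrel S x y z" "x \<in> carrier S" "y \<in> carrier S" "z \<in> U" for x y z
  proof (rule ccontr)
    assume "\<not> (x \<in> U \<or> y \<in> U)"
    then obtain F m G n where F: "finite F" "F \<subseteq> U" "\<not> survives S m (insert x F) W"
      and G: "finite G" "G \<subseteq> U" "\<not> survives S n (insert y G) W"
      using in_U[OF J(2)] in_U[OF J(3)] by blast
    \<comment> \<open>Joining both failing parts, with \<open>z\<close> added so that its split can
      be played, sets up one position at depth \<open>max m n\<close> that refutes both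
      choices.\<close>
    define H where "H = insert z (F \<union> G)"
    have "survives S (Suc (max m n)) H W" using F G J by (intro fin) (auto simp: H_def)
    moreover have "z \<in> H" by (simp add: H_def)
    ultimately have "survives S (max m n) (insert x H) W \<or> survives S (max m n) (insert y H) W"
      unfolding survives.simps using J by blast
    \<comment> \<open>Nothing shows yet that \<open>x\<close> and \<open>y\<close> avoid
      \<open>W\<close>, so the depth is lowered through liveness.\<close>
    moreover have "live S x" "live S y" using J UC unfolding live_def by blast+
    ultimately have "survives S m (insert x H) W \<or> survives S n (insert y H) W"
      by (meson insertI1 max.cobounded1 max.cobounded2 survives_le_live)
    then show False
      using F(3) G(3) survives_antimono[of S m _ W "insert x F"]
        survives_antimono[of S n _ W "insert y G"] unfolding H_def by blast
  qed
  have disj: "\<not> (x \<in> U \<and> y \<in> U)" if "Jrel S x y z" "z \<in> carrier S" for x y z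
  proof
    assume "x \<in> U \<and> y \<in> U"
    then have "survives S 0 {x, y} W" by (intro fin) auto
    then show False using that by simp
  qed
  have "prime_set S U" using UC up prime disj unfolding prime_set_def by blast
  moreover have "U \<inter> W = {}"
  proof -
    have "x \<notin> W" if "x \<in> U" for x using fin[of "{x}" 0] that by simp
    then show ?thesis by blast
  qed
  ultimately show thesis using U(2) that by blast
qed

section \<open>The two directions of the axiomatisation\<close>

text \<open>Each point of the base gives a prime set. A point in the symmetric difference of two
  images separates the elements, and a point in the intersection handles a pair with no disjoint
  union.\<close>

lemma representable_imp_models:
  assumes "representable_over X S"
  shows "models S {rho n | n. True}"
proof -
  obtain A f where A: "disj_union_partial_algebra X A" and f: "bij_betw f (carrier S) A"
    and J: "\<And>a b c. a \<in> carrier S \<Longrightarrow> b \<in> carrier S \<Longrightarrow> c \<in> carrier S \<Longrightarrow>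
      Jrel S a b c \<longleftrightarrow> disj_union (f a) (f b) = Some (f c)"
    using assms unfolding representable_over_def isomorphic_def set_structure_def by auto
  define p where "p x = {m \<in> carrier S. x \<in> f m}" for x
  have p: "prime_set S (p x)" for x
  proof -
    have "f a \<inter> f b = {} \<and> f a \<union> f b = f c"
      if "Jrel S a b c" "a \<in> carrier S" "b \<in> carrier S" "c \<in> carrier S" for a b c
      using J[OF that(2-4)] that(1) by (simp add: disj_union_def split: if_splits)
    then show ?thesis unfolding prime_set_def p_def by blast
  qed
  have sep: "survives S n {a} {b} \<or> survives S n {b} {a}"
    if "a \<in> carrier S" "b \<in> carrier S" "a \<noteq> b" for a b n
  proof -
    have "f a \<noteq> f b" using f that by (auto simp: bij_betw_def inj_on_def)
    then obtain x where "x \<in> f a \<and> x \<notin> f b \<or> x \<in> f b \<and> x \<notin> f a" by blast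
    then show ?thesis
      using prime_set_survives[OF p[of x], of "{a}" "{b}" n]
        prime_set_survives[OF p[of x], of "{b}" "{a}" n] that(1,2)
      by (auto simp: p_def)
  qed
  have meet: "survives S n {a, b} {}"
    if "a \<in> carrier S" "b \<in> carrier S" "\<not> (\<exists>c\<in>carrier S. Jrel S a b c)" for a b n
  proof -
    have "f a \<inter> f b \<noteq> {}"
    proof
      assume "f a \<inter> f b = {}"
      then have d: "disj_union (f a) (f b) = Some (f a \<union> f b)" by (simp add: disj_union_def)
      moreover have "f a \<in> A" "f b \<in> A" using f that by (auto simp: bij_betw_def)
      ultimately have "f a \<union> f b \<in> A"
        using A unfolding disj_union_partial_algebra_def by blast
      then obtain c where "c \<in> carrier S" "f a \<union> f b = f c"
        using f unfolding bij_betw_def by (metis imageE)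
      then show False using J[of a b c] d that by auto
    qed
    then obtain x where "x \<in> f a" "x \<in> f b" by blast
    then show ?thesis
      using prime_set_survives[OF p[of x], of "{a, b}" "{}" n] that(1,2) by (simp add: p_def)
  qed
  show ?thesis unfolding models_rho_iff using sep meet by blast
qed

text \<open>A Stone-type representation: the points are the prime sets, which is why the base type
  is \<open>'a set\<close>.\<close>

lemma models_imp_representable:
  fixes S :: "'a jstructure"
  assumes "models S {rho n | n. True}"
  shows "representable_over (UNIV :: 'a set set) S"
proof -
  have sep: "a = b \<or> survives S n {a} {b} \<or> survives S n {b} {a}"
    and meet: "(\<exists>c\<in>carrier S. Jrel S a b c) \<or> survives S n {a, b} {}"
    if "a \<in> carrier S" "b \<in> carrier S" for a b n
    using assms that unfolding models_rho_iff by blast+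
  define f where "f a = {U. prime_set S U \<and> a \<in> U}" for a
  have inj: "inj_on f (carrier S)"
  proof (rule inj_onI, rule ccontr)
    fix a b assume ab: "a \<in> carrier S" "b \<in> carrier S" "f a = f b" "a \<noteq> b"
    \<comment> \<open>The axioms allow the side to vary with \<open>n\<close>. Failures on both
      sides would persist to the larger depth, so one side works for every \<open>n\<close>.\<close>
    have "(\<forall>n. survives S n {a} {b}) \<or> (\<forall>n. survives S n {b} {a})"
    proof (rule ccontr)
      assume "\<not> ?thesis"
      then obtain m n where "\<not> survives S m {a} {b}" "\<not> survives S n {b} {a}" by blast
      moreover have "survives S (max m n) {a} {b} \<or> survives S (max m n) {b} {a}"
        using sep ab by blast
      ultimately show False
        using survives_le[of m "max m n" S "{a}" "{b}"] survives_le[of n "max m n" S "{b}" "{a}"] ab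
        by auto
    qed
    then obtain U where "prime_set S U" "a \<in> U \<and> b \<notin> U \<or> b \<in> U \<and> a \<notin> U"
      using survives_imp_prime_set[of "{a}" S "{b}"] survives_imp_prime_set[of "{b}" S "{a}"] ab
      by (metis disjoint_insert(1) empty_subsetI finite.intros insert_subset)
    then show False using ab(3) unfolding f_def by blast
  qed
  have J_imp: "f a \<inter> f b = {}" "f a \<union> f b = f c"
    if "Jrel S a b c" "a \<in> carrier S" "b \<in> carrier S" "c \<in> carrier S" for a b c
    using that unfolding f_def prime_set_def by auto
  have ex: "\<exists>c\<in>carrier S. Jrel S a b c"
    if "a \<in> carrier S" "b \<in> carrier S" "f a \<inter> f b = {}" for a b
  proof (rule ccontr)
    assume "\<not> ?thesis"
    then have "\<And>n. survives S n {a, b} {}" using meet that by blast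
    then obtain U where "prime_set S U" "a \<in> U" "b \<in> U"
      using survives_imp_prime_set[of "{a, b}" S "{}"] \<open>a \<in> carrier S\<close> \<open>b \<in> carrier S\<close>
      by (metis empty_subsetI finite.intros insert_subset)
    then show False using \<open>f a \<inter> f b = {}\<close> unfolding f_def by blast
  qed
  have "Jrel S a b c \<longleftrightarrow> disj_union (f a) (f b) = Some (f c)"
    if "a \<in> carrier S" "b \<in> carrier S" "c \<in> carrier S" for a b c
  proof
    assume "Jrel S a b c"
    then show "disj_union (f a) (f b) = Some (f c)"
      using J_imp that by (simp add: disj_union_def)
  next
    assume "disj_union (f a) (f b) = Some (f c)"
    then have *: "f a \<inter> f b = {}" "f a \<union> f b = f c"
      by (auto simp: disj_union_def split: if_splits)
    \<comment> \<open>Some \<open>d\<close> is a disjoint union of \<open>a\<close> and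
      \<open>b\<close>; its image equals that of \<open>c\<close>, and injectivity identifies the
      two.\<close>
    then obtain d where d: "d \<in> carrier S" "Jrel S a b d" using ex \<open>a \<in> _\<close> \<open>b \<in> _\<close> by blast
    then have "f d = f c" using J_imp(2) that *(2) by metis
    then show "Jrel S a b c" using d inj that by (metis inj_onD)
  qed
  then have "isomorphic S (set_structure (f ` carrier S))"
    unfolding isomorphic_def set_structure_def
    by (intro exI[of _ f]) (simp add: inj bij_betw_def)
  moreover have "f a \<union> f b \<in> f ` carrier S"
    if "a \<in> carrier S" "b \<in> carrier S" "f a \<inter> f b = {}" for a b
    using ex[OF that] J_imp(2) that(1,2) by blast
  then have "disj_union_partial_algebra UNIV (f ` carrier S)"
    unfolding disj_union_partial_algebra_def disj_union_def
    by (auto split: if_splits)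
  ultimately show ?thesis unfolding representable_over_def by blast
qed

text \<open>The type \<open>'a set\<close> offers enough points for the equivalence; the second
  conjunct covers representations over any other type \<open>'x\<close>.\<close>

theorem theorem4p5:
  fixes S :: "'a jstructure"
  shows "((\<exists>X :: 'a set set. representable_over X S) \<longleftrightarrow> models S {rho n | n. True})
    \<and> ((\<exists>X :: 'x set. representable_over X S) \<longrightarrow> models S {rho n | n. True})"
  using representable_imp_models[of _ S] models_imp_representable[of S]
    representable_imp_models[of "_ :: 'x set" S] by metis

end
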